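(* Let $A$ be a commutative unitary ring (with $0_A\neq1_A$). Then $\ell_{A[[X]]}=+\infty$, where $A[[X]]$ is the ring of formal power series over $A$.
   Context: All rings are commutative, unitary and nonzero. For a ring $B$ and $a_1,\dots,a_n\in B$, set $M_n(a_1,\dots,a_n)=\begin{pmatrix}a_n&-1\\1&0\end{pmatrix}\cdots\begin{pmatrix}a_1&-1\\1&0\end{pmatrix}$. An $n$-tuple $(a_1,\dots,a_n)\in B^n$ is a $\lambda$-quiddity over $B$ if $M_n(a_1,\dots,a_n)=\epsilon\,\mathrm{Id}$ for some $\epsilon\in\{\pm1_B\}$. For $(a_1,\dots,a_n)\in B^n$, $(b_1,\dots,b_m)\in B^m$ define $(a_1,\dots,a_n)\oplus(b_1,\dots,b_m)=(a_1+b_m,a_2,\dots,a_{n-1},a_n+b_1,b_2,\dots,b_{m-1})$. Two $n$-tuples are equivalent ($\sim$) if one is obtained from the other or from its reversal by a cyclic rotation. A $\lambda$-quiddity $(c_1,\dots,c_n)$ with $n\ge3$ is reducible if there exist a $\lambda$-quiddity $(b_1,\dots,b_l)$ and $(a_1,\dots,a_m)\in B^m$ with $m,l\ge3$ and $(c_1,\dots,c_n)\sim(a_1,\dots,a_m)\oplus(b_1,\dots,b_l)$; otherwise it is irreducible ($(0,0)$ is never irreducible). $\ell_B$ is the maximal size of irreducible $\lambda$-quiddities over $B$ if bounded, and $+\infty$ otherwise. *)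

theory Defs
  imports
    "HOL-Library.Extended_Nat"
    "HOL-Computational_Algebra.Formal_Power_Series"
    "HOL-Analysis.Cartesian_Space"
begin

text \<open>
  An $n$-tuple over a ring is a list of length $n$. The rings are types of class
  comm_ring_1, which are nonzero by the class axiom zero_neq_one.
\<close>

definition elem_mat :: "'a::comm_ring_1 \<Rightarrow> 'a^2^2" where
  "elem_mat a = vector [vector [a, -1], vector [1, 0]]"

text \<open>The factors occur in reverse order: the matrix of the first entry is the rightmost one.\<close>

fun quiddity_mat :: "'a::comm_ring_1 list \<Rightarrow> 'a^2^2" where
  "quiddity_mat [] = mat 1"
| "quiddity_mat (a # as) = quiddity_mat as ** elem_mat a"

definition lambda_quiddity :: "'a::comm_ring_1 list \<Rightarrow> bool" where
  "lambda_quiddity as \<longleftrightarrow> as \<noteq> [] \<and> (\<exists>\<epsilon>\<in>{1, -1}. quiddity_mat as = mat \<epsilon>)"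

text \<open>Only meaningful when both arguments have length at least 2.\<close>

definition tuple_sum :: "'a::comm_ring_1 list \<Rightarrow> 'a list \<Rightarrow> 'a list" where
  "tuple_sum as bs =
     (hd as + last bs) # butlast (tl as) @ (last as + hd bs) # butlast (tl bs)"

definition tuple_equiv :: "'a list \<Rightarrow> 'a list \<Rightarrow> bool" where
  "tuple_equiv as bs \<longleftrightarrow> (\<exists>k. bs = rotate k as \<or> bs = rotate k (rev as))"

definition reducible_quiddity :: "'a::comm_ring_1 list \<Rightarrow> bool" where
  "reducible_quiddity cs \<longleftrightarrow> lambda_quiddity cs \<and> 3 \<le> length cs \<and>
     (\<exists>as bs. 3 \<le> length as \<and> 3 \<le> length bs \<and> lambda_quiddity bs \<and>
        tuple_equiv cs (tuple_sum as bs))"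

text \<open>The length condition only excludes the pair $(0,0)$, which is by convention not irreducible.\<close>

definition irreducible_quiddity :: "'a::comm_ring_1 list \<Rightarrow> bool" where
  "irreducible_quiddity cs \<longleftrightarrow>
     lambda_quiddity cs \<and> 3 \<le> length cs \<and> \<not> reducible_quiddity cs"

definition irreducible_sizes :: "'a::comm_ring_1 itself \<Rightarrow> nat set" where
  "irreducible_sizes _ = {length cs |cs :: 'a list. irreducible_quiddity cs}"

text \<open>
  The set of sizes is never empty: $(1,1,1)$ is always an irreducible quiddity, so in the
  bounded case the maximum is genuine.
\<close>

definition ell :: "'a::comm_ring_1 itself \<Rightarrow> enat" where
  "ell R = (if bdd_above (irreducible_sizes R) then enat (Max (irreducible_sizes R)) else \<infinity>)"

end

theory Submission
  imports Defs
begin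

text \<open>
  Solutions of $M_n(c_1,\dots,c_n) = \mathrm{Id}$ are read off closed sequences of vectors
  $v_i \in B^2$ with $\det(v_i, v_{i+1}) = 1$, through $v_{i+2} = c_i v_{i+1} - v_i$. The
  continuant of a block of consecutive entries is then some $\det(v_i, v_j)$, so that a
  decomposition of the quiddity amounts to a chord: two nonadjacent vectors with determinant
  $\pm 1$. It remains to find arbitrarily long chordless cycles over $A[[X]]$. Take units
  $F_j \equiv 1$ modulo $X^2$, pairwise distinct over a period $N$ (even), and put
  $q_j = F_j^{-1} (0, 1)$ for even $j$ and $q_j = F_j^{-1} (X, 1)$ for odd $j$. Then $q_j$ and
  $q_{j+1}$ have a common neighbour $p_j$, and $\det(p_k, q_j)$ is, up to sign, $F_l / F_j$
  where $l$ is the one of $k, k+1$ with the parity of $j$. Hence $p_k$ and $q_j$ are adjacent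
  only when $j \in \{k, k+1\}$ modulo $N$, while two $p$'s or two $q$'s have determinant in $(X)$.
\<close>

section \<open>Quiddity matrices\<close>

lemma elem_mat_entries [simp]:
  "elem_mat a $ 1 $ 1 = a" "elem_mat a $ 1 $ 2 = -1"
  "elem_mat a $ 2 $ 1 = 1" "elem_mat a $ 2 $ 2 = 0"
  by (simp_all add: elem_mat_def)

lemma matrix_mult_2_entry: "((A :: 'a::comm_ring_1^2^2) ** B) $ i $ j = A $ i $ 1 * B $ 1 $ j + A $ i $ 2 * B $ 2 $ j"
  by (simp add: matrix_matrix_mult_def sum_2)

lemma quiddity_mat_append: "quiddity_mat (xs @ ys) = quiddity_mat ys ** quiddity_mat xs"
  by (induction xs) (simp_all add: matrix_mul_assoc)

text \<open>Conjugating the transpose of an elementary matrix by diag(1, -1) gives the matrix back,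
  and transposition reverses products.\<close>

lemma quiddity_mat_rev:
  "quiddity_mat (rev xs) $ 1 $ 1 = quiddity_mat xs $ 1 $ 1 \<and>
   quiddity_mat (rev xs) $ 1 $ 2 = - quiddity_mat xs $ 2 $ 1 \<and>
   quiddity_mat (rev xs) $ 2 $ 1 = - quiddity_mat xs $ 1 $ 2 \<and>
   quiddity_mat (rev xs) $ 2 $ 2 = quiddity_mat xs $ 2 $ 2"
proof (induction xs)
  case Nil
  then show ?case by (simp add: mat_def)
next
  case (Cons a xs)
  then show ?case
    by (simp add: quiddity_mat_append matrix_mult_2_entry algebra_simps)
qed

text \<open>The second row (1, 0) of \<open>elem_mat b\<close> and the second column (-1, 0) of
  \<open>elem_mat a\<close> isolate the top left entry of the middle factor.\<close>

lemma lambda_quiddity_middle_continuant: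
  assumes "lambda_quiddity (a # xs @ [b])"
  shows "quiddity_mat xs $ 1 $ 1 \<in> {1, -1}"
proof -
  obtain \<epsilon> where \<epsilon>: "\<epsilon> \<in> {1, -1}" "quiddity_mat (a # xs @ [b]) = mat \<epsilon>"
    using assms by (auto simp: lambda_quiddity_def)
  have "quiddity_mat (a # xs @ [b]) $ 2 $ 2 = - quiddity_mat xs $ 1 $ 1"
    by (simp add: quiddity_mat_append matrix_mult_2_entry)
  then have "quiddity_mat xs $ 1 $ 1 = - \<epsilon>"
    using \<epsilon>(2) by (simp add: mat_def)
  then show ?thesis using \<epsilon>(1) by auto
qed

lemma rotate_map_periodic:
  assumes "\<And>i. c (i + n) = c i"
  shows "rotate k (map c [0..<n]) = map c [k..<k + n]"
proof (cases "n = 0")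
  case False
  show ?thesis
  proof (induction k)
    case (Suc k)
    have "[k..<k + n] = k # [Suc k..<k + n]" using False by (simp add: upt_conv_Cons)
    moreover have "[Suc k..<Suc k + n] = [Suc k..<k + n] @ [k + n]" using False by simp
    ultimately show ?case using Suc assms[of k] by (simp add: rotate_Suc)
  qed simp
qed simp

text \<open>The inner entries of the quiddity \<open>bs\<close> survive in the sum as one contiguous
  block, and periodicity unrolls the rotation.\<close>

lemma reducible_periodic_block:
  fixes c :: "nat \<Rightarrow> 'a::comm_ring_1"
  assumes periodic: "\<And>i. c (i + n) = c i"
    and red: "reducible_quiddity (map c [0..<n])"
  obtains i l where "1 \<le> l" "l + 3 \<le> n" "quiddity_mat (map c [i..<i + l]) $ 1 $ 1 \<in> {1, -1}"
proof -
  let ?cs = "map c [0..<n]"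
  obtain as bs k where len: "3 \<le> length as" "3 \<le> length bs" and bs: "lambda_quiddity bs"
    and rot: "tuple_sum as bs = rotate k ?cs \<or> tuple_sum as bs = rotate k (rev ?cs)"
    using red unfolding reducible_quiddity_def tuple_equiv_def by blast
  define ys where "ys = butlast (tl bs)"
  define l where "l = length ys"
  obtain P where P: "tuple_sum as bs = P @ ys" "length P = length as"
  proof
    show "tuple_sum as bs = ((hd as + last bs) # butlast (tl as) @ [last as + hd bs]) @ ys"
      by (simp add: tuple_sum_def ys_def)
    show "length ((hd as + last bs) # butlast (tl as) @ [last as + hd bs]) = length as"
      using len(1) by simp
  qed
  have "bs = hd bs # ys @ [last bs]"
    using len(2) unfolding ys_def
    by (cases bs) (auto simp: append_butlast_last_id simp del: butlast.simps)
  then have K: "quiddity_mat ys $ 1 $ 1 \<in> {1, -1}"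
    using lambda_quiddity_middle_continuant bs by metis
  have "length (tuple_sum as bs) = n" using rot by auto
  then have n: "n = length as + l" using P by (simp add: l_def)
  have l: "1 \<le> l" "l + 3 \<le> n" using len n by (auto simp: l_def ys_def)
  from rot show thesis
  proof
    assume "tuple_sum as bs = rotate k ?cs"
    then have "P @ ys = map c [k..<k + n]" using P rotate_map_periodic[of c n, OF periodic] by metis
    then have "ys = drop (length as) (map c [k..<k + n])" using P(2) by (metis append_eq_conv_conj)
    then have "ys = map c [k + length as..<k + length as + l]"
      by (simp add: drop_map n add.assoc)
    then show thesis using that l K by metis
  next
    assume "tuple_sum as bs = rotate k (rev ?cs)"
    then obtain k' where "P @ ys = rev (rotate k' ?cs)" using P rotate_rev by metis
    then have "rev (P @ ys) = map c [k'..<k' + n]"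
      using rotate_map_periodic[of c n, OF periodic] by (metis rev_rev_ident)
    \<comment> \<open>Reversal moves the block to the front, read backwards; this leaves its top
      left matrix entry unchanged.\<close>
    then have "rev ys = take l (map c [k'..<k' + n])"
      by (metis append_eq_conv_conj l_def length_rev rev_append)
    then have "rev ys = map c [k'..<k' + l]" using l by (simp add: take_map)
    then show thesis using that l K quiddity_mat_rev[of ys] by metis
  qed
qed

section \<open>Chordless cycles\<close>

definition det2 :: "(nat \<Rightarrow> 'a::comm_ring_1) \<Rightarrow> (nat \<Rightarrow> 'a) \<Rightarrow> nat \<Rightarrow> nat \<Rightarrow> 'a" where
  "det2 s t i j = s i * t j - t i * s j"

lemma irreducible_of_chordless_cycle:
  fixes s t :: "nat \<Rightarrow> 'a::comm_ring_1"
  assumes n: "3 \<le> n"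
    and periodic: "\<And>i. s (i + n) = s i" "\<And>i. t (i + n) = t i"
    and adjacent: "\<And>i. det2 s t i (Suc i) = 1"
    and chordless: "\<And>i k. 2 \<le> k \<Longrightarrow> k + 2 \<le> n \<Longrightarrow> det2 s t i (i + k) \<notin> {1, -1}"
  shows "irreducible_quiddity (map (\<lambda>i. det2 s t i (i + 2)) [0..<n])"
proof -
  define c where "c i = det2 s t i (i + 2)" for i
  have c_periodic: "c (i + n) = c i" for i
    using periodic[of i] periodic[of "i + 2"] by (simp add: c_def det2_def add.commute add.left_commute)
  have adj: "s i * t (Suc i) - t i * s (Suc i) = 1" for i
    using adjacent[of i] by (simp add: det2_def)
  have s_rec: "s (Suc (Suc i)) = c i * s (Suc i) - s i" for i
  proof -
    \<comment> \<open>The linear relation between three vectors of the plane, with their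
      determinants as coefficients; the two adjacent ones equal 1.\<close>
    have "s (Suc (Suc i)) * (s i * t (Suc i) - t i * s (Suc i)) = c i * s (Suc i)
        - s i * (s (Suc i) * t (Suc (Suc i)) - t (Suc i) * s (Suc (Suc i)))"
      by (simp add: c_def det2_def algebra_simps)
    then show ?thesis by (simp add: adj)
  qed
  have t_rec: "t (Suc (Suc i)) = c i * t (Suc i) - t i" for i
  proof -
    have "t (Suc (Suc i)) * (s i * t (Suc i) - t i * s (Suc i)) = c i * t (Suc i)
        - t i * (s (Suc i) * t (Suc (Suc i)) - t (Suc i) * s (Suc (Suc i)))"
      by (simp add: c_def det2_def algebra_simps)
    then show ?thesis by (simp add: adj)
  qed
  \<comment> \<open>The induction couples all four entries. The first one matches k entries with a
    chord of length k + 1.\<close>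
  have block: "quiddity_mat (map c [i..<i + k]) $ 1 $ 1 = det2 s t i (Suc (i + k)) \<and>
      quiddity_mat (map c [i..<i + k]) $ 1 $ 2 = - det2 s t (Suc i) (Suc (i + k)) \<and>
      quiddity_mat (map c [i..<i + k]) $ 2 $ 1 = det2 s t i (i + k) \<and>
      quiddity_mat (map c [i..<i + k]) $ 2 $ 2 = - det2 s t (Suc i) (i + k)" for i k
  proof (induction k)
    case 0
    then show ?case using adj[of i] by (simp add: mat_def det2_def algebra_simps)
  next
    case (Suc k)
    have "map c [i..<i + Suc k] = map c [i..<i + k] @ [c (i + k)]" by simp
    then show ?case using Suc
      by (simp add: quiddity_mat_append matrix_mult_2_entry del: upt_Suc)
        (simp add: det2_def s_rec t_rec algebra_simps)
  qed
  have "quiddity_mat (map c [0..<n]) = mat 1"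
    using block[of 0 n] adj[of 0] periodic[of 0] periodic[of 1]
    by (simp add: vec_eq_iff forall_2 mat_def det2_def algebra_simps)
  then have quid: "lambda_quiddity (map c [0..<n])"
    using n by (simp add: lambda_quiddity_def)
  have "\<not> reducible_quiddity (map c [0..<n])"
  proof
    assume "reducible_quiddity (map c [0..<n])"
    then obtain i l where l: "1 \<le> l" "l + 3 \<le> n"
      and "quiddity_mat (map c [i..<i + l]) $ 1 $ 1 \<in> {1, -1}"
      using reducible_periodic_block[of c n, OF c_periodic] by blast
    then have "det2 s t i (i + Suc l) \<in> {1, -1}" using block[of i l] by simp
    then show False using chordless[of "Suc l" i] l by simp
  qed
  then have "irreducible_quiddity (map c [0..<n])"
    using quid n by (simp add: irreducible_quiddity_def)
  then show ?thesis unfolding c_def[abs_def] .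
qed

section \<open>Long cycles over formal power series\<close>

context
  fixes N :: nat
  assumes N: "even N" "0 < N"
begin

text \<open>This is (\<open>unit_at j\<close> - 1) / X, named separately so that a difference of
  units divided by X, the second coordinate of p_j, needs no division.\<close>

definition offset :: "nat \<Rightarrow> 'a::comm_ring_1 fps" where
  "offset j = fps_X ^ Suc (j mod N)"

definition unit_at :: "nat \<Rightarrow> 'a::comm_ring_1 fps" where
  "unit_at j = 1 + fps_X * offset j"

definition inv_unit_at :: "nat \<Rightarrow> 'a::comm_ring_1 fps" where
  "inv_unit_at j = fps_right_inverse (unit_at j) 1"

text \<open>
  The vertex with index $2j$ is $\pm q_j$, the one with index $2j+1$ is $\pm p_j$; the signs,
  of period 4, make all consecutive determinants equal to $1$ rather than $\pm 1$.
\<close>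

definition vertex_fst :: "nat \<Rightarrow> 'a::comm_ring_1 fps" where
  "vertex_fst i = (let j = i div 2 in
     if even i then (if even j then 0 else - fps_X * inv_unit_at j)
     else (if even j then - unit_at j else unit_at (Suc j)))"

definition vertex_snd :: "nat \<Rightarrow> 'a::comm_ring_1 fps" where
  "vertex_snd i = (let j = i div 2 in
     if even i then (if even j then inv_unit_at j else - inv_unit_at j)
     else offset (Suc j) - offset j)"

lemma vertex_fst_simps:
  "vertex_fst (2 * j) = (if even j then 0 else - fps_X * inv_unit_at j)"
  "vertex_fst (Suc (2 * j)) = (if even j then - unit_at j else unit_at (Suc j))"
  by (simp_all add: vertex_fst_def Let_def)

lemma vertex_snd_simps:
  "vertex_snd (2 * j) = (if even j then inv_unit_at j else - inv_unit_at j)"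
  "vertex_snd (Suc (2 * j)) = offset (Suc j) - offset j"
  by (simp_all add: vertex_snd_def Let_def)

lemma offset_nth_0 [simp]: "fps_nth (offset j) 0 = 0"
  by (simp add: offset_def)

lemma unit_at_nth_0 [simp]: "fps_nth (unit_at j) 0 = 1"
  by (simp add: unit_at_def)

lemma unit_at_inverse: "unit_at j * inv_unit_at j = 1"
  unfolding inv_unit_at_def by (rule fps_right_inverse) simp

lemma periodic_index:
  "offset (N + j) = offset j" "unit_at (N + j) = unit_at j" "inv_unit_at (N + j) = inv_unit_at j"
  "offset (Suc (N + j)) = offset (Suc j)" "unit_at (Suc (N + j)) = unit_at (Suc j)"
proof -
  have "Suc (N + j) mod N = Suc j mod N" by (metis add_Suc_right mod_add_self1)
  then show "offset (N + j) = offset j" "unit_at (N + j) = unit_at j" "inv_unit_at (N + j) = inv_unit_at j"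
    "offset (Suc (N + j)) = offset (Suc j)" "unit_at (Suc (N + j)) = unit_at (Suc j)"
    by (simp_all add: offset_def unit_at_def inv_unit_at_def)
qed

text \<open>Since N is even, the shift of j by N preserves its parity, hence both the choice of
  vector and the sign.\<close>

lemma vertex_fst_periodic: "vertex_fst (i + 2 * N) = vertex_fst i" and vertex_snd_periodic: "vertex_snd (i + 2 * N) = vertex_snd i"
  using N(1) by (simp_all add: vertex_fst_def vertex_snd_def Let_def periodic_index)

lemma unit_at_eqD:
  assumes "unit_at i = (unit_at j :: 'a::comm_ring_1 fps)"
  shows "i mod N = j mod N"
proof (rule ccontr)
  assume "i mod N \<noteq> j mod N"
  \<comment> \<open>The degree 2 + i mod N is that of the only nonconstant monomial of
    \<open>unit_at i\<close>.\<close>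
  moreover have "fps_nth (unit_at i) (2 + i mod N) = (fps_nth (unit_at j) (2 + i mod N) :: 'a)" using assms by simp
  ultimately show False by (simp add: unit_at_def offset_def flip: power_Suc)
qed

lemma det2_vertices_adjacent: "det2 vertex_fst vertex_snd i (Suc i) = (1 :: 'a::comm_ring_1 fps)"
proof (cases "even i")
  case True
  then obtain j where "i = 2 * j" by blast
  then show ?thesis using unit_at_inverse[of j, where 'a = 'a]
    by (simp add: det2_def vertex_fst_simps vertex_snd_simps) (simp add: unit_at_def algebra_simps)
next
  case False
  then obtain j where i: "i = Suc (2 * j)" by (auto elim: oddE)
  then have i': "Suc i = 2 * Suc j" by simp
  show ?thesis using unit_at_inverse[of "Suc j", where 'a = 'a]
    unfolding i' unfolding i det2_def vertex_fst_simps vertex_snd_simps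
    by (simp add: unit_at_def algebra_simps)
qed

text \<open>Modulo X all q's have first coordinate 0 and all p's have second coordinate 0.\<close>

lemma det2_vertices_same_parity:
  assumes "even i = even j"
  shows "fps_nth (det2 vertex_fst vertex_snd i j :: 'a::comm_ring_1 fps) 0 = 0"
proof (cases "even i")
  case True
  then show ?thesis using assms by (simp add: det2_def vertex_fst_def vertex_snd_def Let_def)
next
  case False
  then show ?thesis using assms by (simp add: det2_def vertex_fst_def vertex_snd_def Let_def)
qed

lemma det2_vertices_chord:
  assumes "det2 vertex_fst vertex_snd (2 * a) (Suc (2 * b)) \<in> {1, - 1 :: 'a::comm_ring_1 fps}"
  shows "a mod N = b mod N \<or> a mod N = Suc b mod N"
proof -
  \<comment> \<open>The first coordinate of p_b is, up to sign, the unit with even index among b, b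
    + 1. For odd a, the X in q_a times the second coordinate of p_b exchanges it for the other
    unit.\<close>
  define l where "l = (if even a = even b then b else Suc b)"
  have "det2 vertex_fst vertex_snd (2 * a) (Suc (2 * b)) =
      (if even a = even b then inv_unit_at a * unit_at l else - (inv_unit_at a * unit_at l) :: 'a fps)"
    unfolding det2_def vertex_fst_simps vertex_snd_simps
    by (cases "even a"; cases "even b") (simp_all add: unit_at_def l_def algebra_simps)
  then have unit: "inv_unit_at a * unit_at l = (1 :: 'a fps) \<or> inv_unit_at a * unit_at l = (- 1 :: 'a fps)"
    using assms by (metis add.inverse_inverse insertE singletonD)
  have "unit_at l = unit_at a * (inv_unit_at a * unit_at l :: 'a fps)"
    using unit_at_inverse[of a, where 'a = 'a] by (simp flip: mult.assoc)
  then have "unit_at l = (unit_at a :: 'a fps) \<or> unit_at l = (- unit_at a :: 'a fps)"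
    using unit by (metis mult.right_neutral mult_minus_right)
  moreover have "unit_at l = (unit_at a :: 'a fps)" if "unit_at l = (- unit_at a :: 'a fps)"
  proof -
    \<comment> \<open>Comparing constant terms, this case forces characteristic 2.\<close>
    have "(1 :: 'a) = - 1" using that by (metis fps_neg_nth unit_at_nth_0)
    then have "(1 :: 'a fps) = - 1" by (simp add: fps_eq_iff)
    then show ?thesis using that by (metis mult_1 mult_minus_left)
  qed
  ultimately have "l mod N = a mod N" using unit_at_eqD by blast
  then show ?thesis by (auto simp: l_def split: if_splits)
qed

lemma vertices_chordless:
  assumes "2 \<le> k" "k + 2 \<le> 2 * N"
  shows "det2 vertex_fst vertex_snd i (i + k) \<notin> {1, - 1 :: 'a::comm_ring_1 fps}"
proof
  assume chord: "det2 vertex_fst vertex_snd i (i + k) \<in> {1, - 1 :: 'a fps}"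
  then have "fps_nth (det2 vertex_fst vertex_snd i (i + k) :: 'a fps) 0 \<noteq> 0" by auto
  then have "odd k" using det2_vertices_same_parity[of i "i + k", where 'a = 'a] by auto
  \<comment> \<open>With k = 2 * r + 1 the bounds on k give 1 \<le> r \<le> N - 2, so the index
    differences r and r + 1 below lie strictly between 0 and N.\<close>
  have close: False if "a mod N = b mod N" "a < b" "b < a + N" for a b
    using that by (metis add_diff_inverse_nat mod_eq_dvd_iff_nat less_imp_le nat_add_left_cancel_less
        nat_dvd_not_less not_less zero_less_diff)
  show False
  proof (cases "even i")
    case True
    then obtain a where a: "i = 2 * a" by blast
    obtain r where r: "k = Suc (2 * r)" using \<open>odd k\<close> by (auto elim: oddE)
    have "a mod N = (a + r) mod N \<or> a mod N = Suc (a + r) mod N"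
      using chord det2_vertices_chord[of a "a + r", where 'a = 'a] by (simp add: a r)
    then show False using close[of a "a + r"] close[of a "Suc (a + r)"] assms r by auto
  next
    case False
    then obtain b where b: "i = Suc (2 * b)" by (auto elim: oddE)
    obtain r where r: "k = Suc (2 * r)" using \<open>odd k\<close> by (auto elim: oddE)
    define a where "a = Suc (b + r)"
    have ik: "i + k = 2 * a" by (simp add: b r a_def)
    have "det2 vertex_fst vertex_snd (2 * a) (Suc (2 * b)) = - (det2 vertex_fst vertex_snd i (i + k) :: 'a fps)"
      unfolding ik unfolding b det2_def by simp
    then have "a mod N = b mod N \<or> a mod N = Suc b mod N"
      using chord det2_vertices_chord[of a b, where 'a = 'a] by auto
    then show False using close[of b a] close[of "Suc b" a] assms r by (auto simp: a_def)
  qed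
qed

lemma irreducible_size_fps: "2 * N \<in> irreducible_sizes TYPE('a::comm_ring_1 fps)"
proof -
  have "3 \<le> 2 * N" using N by auto
  then have "irreducible_quiddity (map (\<lambda>i. det2 vertex_fst vertex_snd i (i + 2) :: 'a fps) [0..<2 * N])"
    by (intro irreducible_of_chordless_cycle vertex_fst_periodic vertex_snd_periodic det2_vertices_adjacent
        vertices_chordless)
  then show ?thesis unfolding irreducible_sizes_def by force
qed

end

theorem theorem3p13: "ell TYPE('a::comm_ring_1 fps) = \<infinity>"
proof -
  have "\<not> bdd_above (irreducible_sizes TYPE('a fps))"
  proof
    assume "bdd_above (irreducible_sizes TYPE('a fps))"
    then obtain M where M: "\<And>n. n \<in> irreducible_sizes TYPE('a fps) \<Longrightarrow> n \<le> M"
      by (auto simp: bdd_above_def)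
    \<comment> \<open>The period N = 2 * Suc M is even and positive, and the cycle is longer than
      M.\<close>
    have "2 * (2 * Suc M) \<in> irreducible_sizes TYPE('a fps)"
      by (rule irreducible_size_fps) auto
    then show False using M by fastforce
  qed
  then show ?thesis by (simp add: ell_def)
qed

end
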